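(* Let $n\ge 1$ and let $X$ be a random vector in $\mathbb{R}^n$ with log-concave density $f$. Then $$V(X)\leq n,$$ where $V(X)=\mathrm{Var}(-\log f(X))$ is the varentropy of $X$.
   Context: A function $f:\mathbb{R}^n\to[0,\infty)$ is log-concave if $f=e^{-U}$ for some convex function $U:\mathbb{R}^n\to(-\infty,+\infty]$ (i.e. $U(tx+(1-t)y)\le tU(x)+(1-t)U(y)$ for all $x,y\in\mathbb{R}^n$, $0<t<1$). A log-concave density is a probability density function (with respect to Lebesgue measure on $\mathbb{R}^n$) that is log-concave. For a random vector $X$ with density $f$, the information content is the random variable $\tilde h(X)=-\log f(X)$, and the varentropy is $V(X)=\mathrm{Var}(\tilde h(X))=\int_{\mathbb{R}^n} f(\log f)^2-\big(\int_{\mathbb{R}^n} f\log f\big)^2$. *)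

theory Defs
  imports "HOL-Probability.Probability"
begin

definition ereal_convex :: "('a::real_vector \<Rightarrow> ereal) \<Rightarrow> bool" where
  "ereal_convex U \<longleftrightarrow>
    (\<forall>x y. \<forall>t. 0 < t \<and> t < 1 \<longrightarrow>
      U (t *\<^sub>R x + (1 - t) *\<^sub>R y) \<le> ereal t * U x + ereal (1 - t) * U y)"

text \<open>The function \<open>u \<mapsto> e\<^sup>-\<^sup>u\<close> on \<open>(-\<infinity>, \<infinity>]\<close>; the value at \<open>-\<infinity>\<close> is irrelevant, since
  it is excluded wherever the function is used.\<close>

definition exp_minus :: "ereal \<Rightarrow> real" where
  "exp_minus u = (if u = \<infinity> then 0 else exp (- real_of_ereal u))"

definition log_concave :: "('a::real_vector \<Rightarrow> real) \<Rightarrow> bool" where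
  "log_concave f \<longleftrightarrow>
    (\<exists>U :: 'a \<Rightarrow> ereal. (\<forall>x. U x \<noteq> -\<infinity>) \<and> ereal_convex U \<and> (\<forall>x. f x = exp_minus (U x)))"

text \<open>Where the density vanishes, \<open>ln 0 = 0\<close> is used instead of \<open>-\<infinity>\<close>; if \<open>f\<close> is a density
  of \<open>X\<close>, then \<open>f (X \<omega>) = 0\<close> only on a null set, so this does not affect the random variable
  up to almost sure equality.\<close>

definition information_content :: "('a \<Rightarrow> real) \<Rightarrow> 'a \<Rightarrow> real" where
  "information_content f x = - ln (f x)"

text \<open>The value is meaningful only if the information content is square integrable.\<close>

definition varentropy :: "'b measure \<Rightarrow> ('b \<Rightarrow> 'a) \<Rightarrow> ('a \<Rightarrow> real) \<Rightarrow> real" where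
  "varentropy M X f = prob_space.variance M (\<lambda>\<omega>. information_content f (X \<omega>))"

end

theory Submission
  imports Defs
begin

text \<open>
  Let \<open>f = e\<^sup>-\<^sup>U\<close> be the density, \<open>Y = - ln f(X)\<close> the information content and \<open>F r = \<integral> f\<^sup>r\<close>, so that
  \<open>F (1 - r)\<close> is the exponential moment \<open>E (exp (r * Y))\<close>. The variance of \<open>Y\<close> is the second
  derivative of \<open>ln F\<close> at \<open>1\<close>, so the bound says that \<open>ln (r\<^sup>n * F r)\<close> has a nonpositive second
  derivative at \<open>1\<close>. In fact \<open>r\<^sup>n * F r\<close> is log-concave in \<open>r > 0\<close>, because
  \<open>r\<^sup>n * F r = \<integral> f (x / r)\<^sup>r dx\<close> and the exponent \<open>r * U (x / r)\<close> of the
  integrand, the perspective of a convex function, is jointly convex in \<open>x\<close> and \<open>r\<close>: integrals of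
  such functions over \<open>x\<close> are log-concave in \<open>r\<close> by the Prekopa-Leindler inequality.

  The derivatives can be avoided. Comparing \<open>r = 1 + e\<close> and \<open>r = 1 - e\<close> with their midpoint gives
  \<open>(1 - e\<^sup>2)\<^sup>n * F (1 + e) * F (1 - e) \<le> (F 1)\<^sup>2 = 1\<close>, which is \<open>log_concave_nn_integral_powr\<close>.
  Since the left side is a product of positive factors in \<open>[0, \<infinity>]\<close>, this also shows that the
  exponential moments are finite, hence that \<open>Y\<close> is square integrable. On the other hand
  \<open>F (1 + e) * F (1 - e) \<ge> 1 + e\<^sup>2 * Var Y\<close>, because \<open>cosh t \<ge> 1 + t\<^sup>2 / 2\<close>. The two bounds
  together, for \<open>e\<close> tending to \<open>0\<close>, give \<open>Var Y \<le> n\<close>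
  (\<open>variance_le_of_exponential_moments\<close>).

  Only the midpoint case of Prekopa-Leindler is involved. It is stated without square roots, as an
  inequality in \<open>[0, \<infinity>]\<close>: if \<open>f x * g y\<close> is at most the square of \<open>h\<close> at the midpoint of \<open>x\<close>
  and \<open>y\<close>, then the product of the integrals of \<open>f\<close> and \<open>g\<close> is at most the square of that of
  \<open>h\<close>. On the line it follows from the Brunn-Minkowski inequality applied to superlevel sets; in
  \<open>n\<close> dimensions by integrating out one coordinate after the other.
\<close>

section \<open>Brunn-Minkowski on the line, for midpoints\<close>

text \<open>The points of \<open>A\<close> approach its supremum along an increasing sequence, so the parts of \<open>A\<close>
  to the left of these points exhaust \<open>A\<close>, except possibly for the maximum. The summand \<open>d\<close> is
  carried along because it may be infinite and then cannot be subtracted from \<open>c\<close>.\<close>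
lemma emeasure_add_le_of_left_parts:
  fixes A :: "real set" and c d :: ennreal
  assumes [measurable]: "A \<in> sets borel" and "A \<noteq> {}"
    and le: "\<And>a. a \<in> A \<Longrightarrow> emeasure lborel (A \<inter> {..<a}) + d \<le> c"
  shows "emeasure lborel A + d \<le> c"
proof -
  \<comment> \<open>\<open>A\<close> may be unbounded, so its supremum is taken in the extended reals.\<close>
  obtain s :: "nat \<Rightarrow> ereal" where s: "incseq s" "range s \<subseteq> ereal ` A" "(SUP a\<in>A. ereal a) = (SUP i. s i)"
    using Sup_countable_SUP[of "ereal ` A"] \<open>A \<noteq> {}\<close> by auto
  have "\<forall>n. \<exists>x\<in>A. s n = ereal x" using s(2) by auto
  then obtain X where X: "\<And>n. X n \<in> A" "\<And>n. s n = ereal (X n)" by metis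
  have "incseq X" using s(1) by (simp add: incseq_def X)
  then have inc: "incseq (\<lambda>n. A \<inter> {..<X n})" by (fastforce simp: incseq_def)
  have max: "y \<le> x" if "x \<in> A" "y \<in> A" "\<And>n. X n \<le> x" for x y
  proof -
    have "ereal y \<le> (SUP i. s i)" unfolding s(3)[symmetric] using that by (auto intro: SUP_upper)
    also have "\<dots> \<le> ereal x" using that by (auto intro!: SUP_least simp: X)
    finally show ?thesis by simp
  qed
  let ?R = "A - (\<Union>n. A \<inter> {..<X n})"
  have R: "y \<in> A" "X n \<le> y" if "y \<in> ?R" for y n
    using that by (simp_all add: not_less)
  have "x = y" if "x \<in> ?R" "y \<in> ?R" for x y
    using max[OF R(1)[OF that(1)] R(1)[OF that(2)] R(2)[OF that(1)]]
      max[OF R(1)[OF that(2)] R(1)[OF that(1)] R(2)[OF that(2)]] by (rule order.antisym[rotated])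
  then have "\<exists>m. ?R \<subseteq> {m}" by (metis all_not_in_conv empty_subsetI singleton_iff subsetI)
  then obtain m where m: "?R \<subseteq> {m}" ..
  have "emeasure lborel A = emeasure lborel (\<Union>n. A \<inter> {..<X n})"
  proof (rule emeasure_eq_AE)
    show "AE x in lborel. x \<in> A \<longleftrightarrow> x \<in> (\<Union>n. A \<inter> {..<X n})"
      using AE_lborel_singleton[of m] by eventually_elim (use m in blast)
  qed auto
  moreover have "(\<lambda>n. emeasure lborel (A \<inter> {..<X n})) \<longlonglongrightarrow> emeasure lborel (\<Union>n. A \<inter> {..<X n})"
    using inc by (intro Lim_emeasure_incseq) auto
  ultimately have "(\<lambda>n. emeasure lborel (A \<inter> {..<X n}) + d) \<longlonglongrightarrow> emeasure lborel A + d"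
    by (auto intro!: tendsto_intros)
  then show ?thesis by (rule LIMSEQ_le_const2) (use le X(1) in blast)
qed

lemma emeasure_lborel_reflect:
  fixes A :: "real set"
  assumes "A \<in> sets borel"
  shows "emeasure lborel (uminus -` A) = emeasure lborel A"
  using assms emeasure_distr[of uminus lborel borel A] by (simp add: lborel_distr_uminus)

lemma emeasure_add_le_of_right_parts:
  fixes A :: "real set" and c d :: ennreal
  assumes A[measurable]: "A \<in> sets borel" and "A \<noteq> {}"
    and le: "\<And>a. a \<in> A \<Longrightarrow> emeasure lborel (A \<inter> {a<..}) + d \<le> c"
  shows "emeasure lborel A + d \<le> c"
proof -
  have m: "uminus -` A \<in> sets borel"
    using measurable_sets[of uminus borel borel A] by simp
  have "emeasure lborel (uminus -` A) + d \<le> c"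
  proof (rule emeasure_add_le_of_left_parts[OF m])
    show "uminus -` A \<noteq> {}" using \<open>A \<noteq> {}\<close> by (metis all_not_in_conv minus_minus vimage_eq)
    fix a assume "a \<in> uminus -` A"
    then have "- a \<in> A" by simp
    have "emeasure lborel (uminus -` A \<inter> {..<a}) = emeasure lborel (uminus -` (A \<inter> {- a<..}))"
      by (rule arg_cong[where f = "emeasure lborel"]) auto
    also have "\<dots> = emeasure lborel (A \<inter> {- a<..})" by (rule emeasure_lborel_reflect) simp
    finally show "emeasure lborel (uminus -` A \<inter> {..<a}) + d \<le> c"
      using le[OF \<open>- a \<in> A\<close>] by (rule ord_eq_le_trans[OF arg_cong2[where f = "(+)", OF _ refl]])
  qed
  then show ?thesis unfolding emeasure_lborel_reflect[OF A] .
qed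

lemma emeasure_lborel_translate:
  fixes A :: "real set"
  assumes "A \<in> sets borel"
  shows "emeasure lborel ((\<lambda>x. t + x) -` A) = emeasure lborel A"
  using assms emeasure_distr[of "(+) t" lborel borel A] by (simp add: lborel_distr_plus)

text \<open>For \<open>a \<in> A\<close> and \<open>b \<in> B\<close>, the set of all sums contains \<open>b + (A \<inter> {..<a})\<close> and
  \<open>a + (B \<inter> {b<..})\<close>, and these two translates lie on different sides of \<open>a + b\<close>. Hence the
  measures of the two parts add up to at most that of any set containing all sums; letting \<open>a\<close>
  and \<open>b\<close> move to the right end of \<open>A\<close> and the left end of \<open>B\<close> gives the claim. The set \<open>C\<close> is
  arbitrary since the set of midpoints of two Borel sets need not be Borel.\<close>
lemma brunn_minkowski_midpoints_real:
  fixes A B C :: "real set"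
  assumes [measurable]: "A \<in> sets borel" "B \<in> sets borel" "C \<in> sets borel"
    and ne: "A \<noteq> {}" "B \<noteq> {}"
    and mid: "\<And>a b. a \<in> A \<Longrightarrow> b \<in> B \<Longrightarrow> (a + b) / 2 \<in> C"
  shows "emeasure lborel A + emeasure lborel B \<le> 2 * emeasure lborel C"
proof -
  define D where "D = (\<lambda>u::real. u / 2) -` C"
  have [measurable]: "D \<in> sets borel"
    unfolding D_def using measurable_sets[of "\<lambda>u::real. u / 2" borel borel C] by simp
  have "emeasure lborel D = (\<integral>\<^sup>+u. indicator D u \<partial>lborel)" by simp
  also have "\<dots> = 2 * (\<integral>\<^sup>+u. indicator D (0 + 2 * u) \<partial>lborel)"
    by (subst nn_integral_real_affine[where c = 2 and t = 0]) auto
  also have "\<dots> = 2 * (\<integral>\<^sup>+u. indicator C u \<partial>lborel)"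
    by (simp add: D_def indicator_def)
  finally have D: "emeasure lborel D = 2 * emeasure lborel C" by simp
  have split: "emeasure lborel (A \<inter> {..<a}) + emeasure lborel (B \<inter> {b<..}) \<le> emeasure lborel D"
    if "a \<in> A" "b \<in> B" for a b
  proof -
    let ?A = "(\<lambda>x. - b + x) -` (A \<inter> {..<a})" and ?B = "(\<lambda>x. - a + x) -` (B \<inter> {b<..})"
    have [measurable]: "?A \<in> sets borel" "?B \<in> sets borel"
      using measurable_sets[of "\<lambda>x. - b + x" borel borel "A \<inter> {..<a}"]
        measurable_sets[of "\<lambda>x. - a + x" borel borel "B \<inter> {b<..}"] by simp_all
    have "x \<in> D" if "x \<in> ?A \<union> ?B" for x
      using that mid[of "x - b" b] mid[of a "x - a"] \<open>a \<in> A\<close> \<open>b \<in> B\<close> by (auto simp: D_def)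
    then have sub: "?A \<union> ?B \<subseteq> D" by blast
    have "emeasure lborel ?A + emeasure lborel ?B = emeasure lborel (?A \<union> ?B)"
      by (rule plus_emeasure) auto
    also have "\<dots> \<le> emeasure lborel D" using sub by (rule emeasure_mono) simp
    finally have "emeasure lborel ?A + emeasure lborel ?B \<le> emeasure lborel D" .
    moreover have "emeasure lborel ?A = emeasure lborel (A \<inter> {..<a})"
      "emeasure lborel ?B = emeasure lborel (B \<inter> {b<..})"
      by (rule emeasure_lborel_translate; simp)+
    ultimately show ?thesis by metis
  qed
  have "emeasure lborel A + emeasure lborel (B \<inter> {b<..}) \<le> emeasure lborel D" if "b \<in> B" for b
    by (rule emeasure_add_le_of_left_parts) (use split that ne in auto)
  then have "emeasure lborel (B \<inter> {b<..}) + emeasure lborel A \<le> emeasure lborel D" if "b \<in> B" for b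
    using that by (simp add: add.commute)
  then have "emeasure lborel B + emeasure lborel A \<le> emeasure lborel D"
    using emeasure_add_le_of_right_parts[of B "emeasure lborel A" "emeasure lborel D"] ne by simp
  then show ?thesis by (simp add: D add.commute)
qed

section \<open>The Prekopa-Leindler inequality for midpoints\<close>
lemma nn_integral_eq_nn_integral_level_sets:
  fixes f :: "real \<Rightarrow> ennreal"
  assumes [measurable]: "f \<in> borel_measurable borel"
  shows "(\<integral>\<^sup>+x. f x \<partial>lborel)
    = (\<integral>\<^sup>+s. indicator {0..} s * emeasure lborel {x. ennreal s < f x} \<partial>lborel)"
proof -
  have lev: "(\<integral>\<^sup>+s. indicator {0..} s * indicator {s. ennreal s < u} s \<partial>lborel) = u" for u :: ennreal
  proof (cases u)
    case (real r)
    have "(\<integral>\<^sup>+s. indicator {0..} s * indicator {s. ennreal s < u} s \<partial>lborel)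
       = (\<integral>\<^sup>+s. indicator {0..<r} s \<partial>lborel)"
      using real by (intro nn_integral_cong) (auto simp: indicator_def ennreal_less_iff)
    then show ?thesis using real by simp
  next
    case top
    have "emeasure lborel {0::real..} = \<top>"
    proof (rule ccontr)
      assume fin: "emeasure lborel {0::real..} \<noteq> \<top>"
      obtain r where r: "emeasure lborel {0::real..} = ennreal r" "0 \<le> r" using fin by (cases "emeasure lborel {0::real..}") auto
      have "emeasure lborel {0..r+1} \<le> emeasure lborel {0::real..}" by (rule emeasure_mono) auto
      then show False using r by simp
    qed
    moreover have "(\<integral>\<^sup>+s. indicator {0..} s * indicator {s. ennreal s < u} s \<partial>lborel)
       = (\<integral>\<^sup>+s. indicator {0::real..} s \<partial>lborel)"
      using top by (intro nn_integral_cong) (auto simp: indicator_def)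
    ultimately show ?thesis using top by simp
  qed
  have "(\<integral>\<^sup>+x. f x \<partial>lborel)
     = (\<integral>\<^sup>+x. \<integral>\<^sup>+s. indicator {0..} s * indicator {s. ennreal s < f x} s \<partial>lborel \<partial>lborel)"
    by (simp add: lev)
  also have "\<dots> = (\<integral>\<^sup>+s. \<integral>\<^sup>+x. indicator {0..} s * indicator {s. ennreal s < f x} s \<partial>lborel \<partial>lborel)"
    by (intro lborel_pair.Fubini') simp
  also have "\<dots> = (\<integral>\<^sup>+s. indicator {0..} s * (\<integral>\<^sup>+x. indicator {x. ennreal s < f x} x \<partial>lborel) \<partial>lborel)"
    by (intro nn_integral_cong) (simp add: nn_integral_cmult[symmetric] indicator_def)
  finally show ?thesis by simp
qed

lemma mult_le_power2_of_add_le: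
  fixes u v w :: ennreal
  assumes "u + v \<le> 2 * w"
  shows "u * v \<le> w\<^sup>2"
proof (cases "w = \<top>")
  case True then show ?thesis by (simp add: power2_eq_square ennreal_top_mult)
next
  case False
  then obtain w' where w: "w = ennreal w'" "w' \<ge> 0" by (cases w) auto
  have "u + v < \<top>"
    using assms by (rule le_less_trans) (simp add: w ennreal_mult_less_top)
  then obtain u' v' where uv: "u = ennreal u'" "u' \<ge> 0" "v = ennreal v'" "v' \<ge> 0"
    by (cases u; cases v) auto
  have "2 * w = ennreal (2 * w')" using w by (simp add: ennreal_mult)
  then have le: "u' + v' \<le> 2 * w'"
    using assms uv w by (simp flip: ennreal_plus)
  have "4 * (u' * v') \<le> (u' + v')\<^sup>2" using zero_le_power2[of "u' - v'"] by (simp add: power2_eq_square algebra_simps)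
  also have "\<dots> \<le> (2 * w')\<^sup>2" using le uv by (intro power_mono) auto
  finally have "u' * v' \<le> w'\<^sup>2" by simp
  then show ?thesis using uv w by (simp add: ennreal_mult[symmetric] ennreal_power)
qed

lemma min_le_of_mult_le_power2:
  fixes u v w :: ennreal
  assumes "u * v \<le> w\<^sup>2"
  shows "min u v \<le> w"
proof (rule ccontr)
  assume "\<not> min u v \<le> w"
  then have w: "w < min u v" by (simp only: not_le)
  then have "w < \<top>" using less_top by fastforce
  have "w\<^sup>2 < min u v * min u v"
  proof (cases "w = 0")
    case False
    then have "w * w < w * min u v"
      using w \<open>w < \<top>\<close> by (intro ennreal_mult_strict_left_mono) (auto simp: zero_less_iff_neq_zero)
    also have "\<dots> \<le> min u v * min u v" using w by (intro mult_right_mono) auto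
    finally show ?thesis by (simp add: power2_eq_square)
  qed (use w in \<open>auto simp: ennreal_zero_less_mult_iff\<close>)
  also have "\<dots> \<le> u * v" by (intro mult_mono) auto
  finally show False using assms by simp
qed

text \<open>At each level \<open>s < 1\<close> the superlevel sets of \<open>f\<close> and \<open>g\<close> are nonempty and their midpoints
  lie in that of \<open>h\<close>, so Brunn-Minkowski applies; at levels \<open>s \<ge> 1\<close> the sets of \<open>f\<close> and \<open>g\<close>
  are empty. Integrating over \<open>s\<close> even gives a bound for the arithmetic mean of the integrals. The
  normalization of the suprema makes \<open>f\<close> and \<open>g\<close> run out of nonempty level sets
  simultaneously: Brunn-Minkowski fails if exactly one of the two sets is empty.\<close>
lemma prekopa_leindler_real_normalized:
  fixes f g h :: "real \<Rightarrow> ennreal"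
  assumes [measurable]: "f \<in> borel_measurable borel" "g \<in> borel_measurable borel" "h \<in> borel_measurable borel"
    and le: "\<And>x y. f x * g y \<le> (h ((x + y) / 2))\<^sup>2"
    and sup: "(SUP x. f x) = 1" "(SUP x. g x) = 1"
  shows "(\<integral>\<^sup>+x. f x \<partial>lborel) + (\<integral>\<^sup>+x. g x \<partial>lborel) \<le> 2 * (\<integral>\<^sup>+x. h x \<partial>lborel)"
proof -
  have "emeasure lborel {x. ennreal s < f x} + emeasure lborel {x. ennreal s < g x}
      \<le> 2 * emeasure lborel {x. ennreal s < h x}" if "s \<ge> 0" for s
  proof (cases "s < 1")
    case True
    have "ennreal s < h ((x + y) / 2)" if "ennreal s < f x" "ennreal s < g y" for x y
      using min_le_of_mult_le_power2[OF le[of x y]] that by (metis min_less_iff_conj less_le_trans)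
    moreover have "\<exists>x. ennreal s < f x" "\<exists>x. ennreal s < g x"
      using True sup less_SUP_iff[of "ennreal s" f UNIV] less_SUP_iff[of "ennreal s" g UNIV] \<open>s \<ge> 0\<close>
      by (auto simp: ennreal_less_iff)
    ultimately show ?thesis by (intro brunn_minkowski_midpoints_real) auto
  next
    case False
    have "\<not> ennreal s < f x" "\<not> ennreal s < g x" for x
      using SUP_upper[of x UNIV f] SUP_upper[of x UNIV g] sup False
      by (auto simp: not_less intro: order.trans)
    then show ?thesis by simp
  qed
  then have *: "(indicator {0..} s :: ennreal) * emeasure lborel {x. ennreal s < f x}
        + indicator {0..} s * emeasure lborel {x. ennreal s < g x}
      \<le> 2 * (indicator {0..} s * emeasure lborel {x. ennreal s < h x})" for s
    by (auto simp: indicator_def)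
  show ?thesis
    unfolding nn_integral_eq_nn_integral_level_sets[OF assms(1)]
      nn_integral_eq_nn_integral_level_sets[OF assms(2)]
      nn_integral_eq_nn_integral_level_sets[OF assms(3)]
    by (subst nn_integral_add[symmetric], simp, simp, subst nn_integral_cmult[symmetric], simp)
       (intro nn_integral_mono *)
qed

text \<open>Dividing \<open>f\<close>, \<open>g\<close> and \<open>h\<close> by \<open>a = sup f\<close>, \<open>b = sup g\<close> and \<open>c = sqrt (a * b)\<close>
  preserves the hypothesis and reduces to the normalized case, whose arithmetic mean bounds the
  geometric one.\<close>
lemma prekopa_leindler_real_bounded:
  fixes f g h :: "real \<Rightarrow> ennreal"
  assumes [measurable]: "f \<in> borel_measurable borel" "g \<in> borel_measurable borel" "h \<in> borel_measurable borel"
    and le: "\<And>x y. f x * g y \<le> (h ((x + y) / 2))\<^sup>2"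
    and fin: "(SUP x. f x) < \<top>" "(SUP x. g x) < \<top>"
  shows "(\<integral>\<^sup>+x. f x \<partial>lborel) * (\<integral>\<^sup>+x. g x \<partial>lborel) \<le> (\<integral>\<^sup>+x. h x \<partial>lborel)\<^sup>2"
proof (cases "(SUP x. f x) = 0 \<or> (SUP x. g x) = 0")
  case True
  then have "(\<forall>x. f x = 0) \<or> (\<forall>x. g x = 0)"
    by (metis SUP_upper UNIV_I le_zero_eq)
  then show ?thesis by auto
next
  case False
  obtain a b where a: "(SUP x. f x) = ennreal a" "a > 0" and b: "(SUP x. g x) = ennreal b" "b > 0"
    using fin False by (cases "SUP x. f x"; cases "SUP x. g x") (auto simp: ennreal_eq_0_iff not_le)
  define c where "c = sqrt (a * b)"
  have c: "c > 0" "c\<^sup>2 = a * b" using a b by (auto simp: c_def)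
  have inv: "ennreal r * ennreal (1 / r) = 1" if "r > 0" for r
    using that by (simp add: ennreal_mult[symmetric])
  define F G H where "F = integral\<^sup>N lborel f" and "G = integral\<^sup>N lborel g" and "H = integral\<^sup>N lborel h"
  have "(\<integral>\<^sup>+x. ennreal (1 / a) * f x \<partial>lborel) + (\<integral>\<^sup>+x. ennreal (1 / b) * g x \<partial>lborel)
      \<le> 2 * (\<integral>\<^sup>+x. ennreal (1 / c) * h x \<partial>lborel)"
  proof (rule prekopa_leindler_real_normalized)
    have "(SUP x. ennreal (1 / a) * f x) = ennreal (1 / a) * ennreal a"
      "(SUP x. ennreal (1 / b) * g x) = ennreal (1 / b) * ennreal b"
      by (simp_all only: SUP_mult_left_ennreal[symmetric] a b)
    then show "(SUP x. ennreal (1 / a) * f x) = 1" "(SUP x. ennreal (1 / b) * g x) = 1"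
      using inv[of a] inv[of b] a b by (simp_all only: mult.commute)
    fix x y
    have cc: "(ennreal (1 / c))\<^sup>2 = ennreal (1 / a) * ennreal (1 / b)"
      using a b c by (simp add: ennreal_power ennreal_mult[symmetric] power_divide)
    have "ennreal (1 / a) * f x * (ennreal (1 / b) * g y) = (ennreal (1 / c))\<^sup>2 * (f x * g y)"
      unfolding cc by (simp add: ac_simps)
    also have "\<dots> \<le> (ennreal (1 / c))\<^sup>2 * (h ((x + y) / 2))\<^sup>2" by (intro mult_left_mono le) simp
    finally show "ennreal (1 / a) * f x * (ennreal (1 / b) * g y) \<le> (ennreal (1 / c) * h ((x + y) / 2))\<^sup>2"
      by (simp add: power_mult_distrib)
  qed simp_all
  then have "ennreal (1 / a) * F + ennreal (1 / b) * G \<le> 2 * (ennreal (1 / c) * H)"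
    by (simp add: F_def G_def H_def nn_integral_cmult)
  then have "ennreal (1 / a) * F * (ennreal (1 / b) * G) \<le> (ennreal (1 / c) * H)\<^sup>2"
    by (rule mult_le_power2_of_add_le)
  then have "(ennreal c)\<^sup>2 * (ennreal (1 / a) * F * (ennreal (1 / b) * G)) \<le> (ennreal c)\<^sup>2 * (ennreal (1 / c) * H)\<^sup>2"
    by (rule mult_left_mono) simp
  also have "(ennreal c)\<^sup>2 * (ennreal (1 / c) * H)\<^sup>2 = (ennreal c * ennreal (1 / c) * H)\<^sup>2"
    by (simp add: power_mult_distrib ac_simps)
  also have "\<dots> = H\<^sup>2" using inv[OF c(1)] by simp
  also have "(ennreal c)\<^sup>2 = ennreal a * ennreal b"
    using a b c by (simp add: ennreal_power ennreal_mult[symmetric])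
  also have "ennreal a * ennreal b * (ennreal (1 / a) * F * (ennreal (1 / b) * G))
     = (ennreal a * ennreal (1 / a)) * (ennreal b * ennreal (1 / b)) * (F * G)" by (simp only: ac_simps)
  also have "\<dots> = F * G" using inv[OF a(2)] inv[OF b(2)] by simp
  finally show ?thesis by (simp add: F_def G_def H_def)
qed

lemma nn_integral_truncate_SUP:
  fixes f :: "'a \<Rightarrow> ennreal"
  assumes [measurable]: "f \<in> borel_measurable M"
  shows "(\<integral>\<^sup>+x. f x \<partial>M) = (SUP n::nat. \<integral>\<^sup>+x. min (f x) (of_nat n) \<partial>M)"
proof -
  have "(SUP n::nat. min u (of_nat n)) = u" for u :: ennreal
  proof (rule antisym)
    show "u \<le> (SUP n::nat. min u (of_nat n))"
    proof (cases "u = \<top>")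
      case True
      then show ?thesis by (simp add: ennreal_SUP_of_nat_eq_top)
    next
      case False
      then obtain n :: nat where "u < of_nat n" using ennreal_Ex_less_of_nat[of u] by (auto simp: less_top)
      then show ?thesis by (intro SUP_upper2[of n]) auto
    qed
  qed (auto intro: SUP_least)
  then have "(\<integral>\<^sup>+x. f x \<partial>M) = (\<integral>\<^sup>+x. (SUP n::nat. min (f x) (of_nat n)) \<partial>M)" by simp
  also have "\<dots> = (SUP n::nat. \<integral>\<^sup>+x. min (f x) (of_nat n) \<partial>M)"
    by (rule nn_integral_monotone_convergence_SUP)
       (auto simp: incseq_def le_fun_def intro!: min.coboundedI2)
  finally show ?thesis .
qed

text \<open>Bounded functions suffice because truncating \<open>f\<close> and \<open>g\<close> preserves the hypothesis with the
  same \<open>h\<close>. Allowing the value \<open>\<infinity>\<close> and unbounded functions matters in several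
  dimensions, where the inequality is applied to marginals, which may be infinite.\<close>
theorem prekopa_leindler_real:
  fixes f g h :: "real \<Rightarrow> ennreal"
  assumes [measurable]: "f \<in> borel_measurable borel" "g \<in> borel_measurable borel" "h \<in> borel_measurable borel"
    and le: "\<And>x y. f x * g y \<le> (h ((x + y) / 2))\<^sup>2"
  shows "(\<integral>\<^sup>+x. f x \<partial>lborel) * (\<integral>\<^sup>+x. g x \<partial>lborel) \<le> (\<integral>\<^sup>+x. h x \<partial>lborel)\<^sup>2"
proof -
  have "(\<integral>\<^sup>+x. min (f x) (of_nat m) \<partial>lborel) * (\<integral>\<^sup>+x. min (g x) (of_nat n) \<partial>lborel) \<le> (\<integral>\<^sup>+x. h x \<partial>lborel)\<^sup>2"
    for m n :: nat
  proof (rule prekopa_leindler_real_bounded)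
    fix x y
    have "min (f x) (of_nat m) * min (g y) (of_nat n) \<le> f x * g y" by (intro mult_mono) auto
    then show "min (f x) (of_nat m) * min (g y) (of_nat n) \<le> (h ((x + y) / 2))\<^sup>2" using le order.trans by blast
    have "(SUP x. min (u x) (of_nat k)) < \<top>" for u :: "real \<Rightarrow> ennreal" and k :: nat
      by (rule le_less_trans[of _ "of_nat k"]) (auto intro: SUP_least simp: of_nat_less_top)
    then show "(SUP x. min (f x) (of_nat m)) < \<top>" "(SUP x. min (g x) (of_nat n)) < \<top>" by blast+
  qed measurable
  then show ?thesis
    by (simp add: nn_integral_truncate_SUP[of f] nn_integral_truncate_SUP[of g]
        SUP_mult_left_ennreal SUP_mult_right_ennreal SUP_le_iff)
qed

text \<open>Induction on the coordinates: integrating out one coordinate by the inequality on the line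
  shows that the marginals satisfy the hypothesis in the remaining coordinates.\<close>
theorem prekopa_leindler_PiM:
  fixes f g h :: "('i \<Rightarrow> real) \<Rightarrow> ennreal"
  assumes "finite I"
    and "f \<in> borel_measurable (\<Pi>\<^sub>M i\<in>I. lborel)" "g \<in> borel_measurable (\<Pi>\<^sub>M i\<in>I. lborel)"
      "h \<in> borel_measurable (\<Pi>\<^sub>M i\<in>I. lborel)"
    and "\<And>x y. x \<in> extensional I \<Longrightarrow> y \<in> extensional I \<Longrightarrow> f x * g y \<le> (h (\<lambda>i\<in>I. (x i + y i) / 2))\<^sup>2"
  shows "(\<integral>\<^sup>+x. f x \<partial>(\<Pi>\<^sub>M i\<in>I. lborel)) * (\<integral>\<^sup>+x. g x \<partial>(\<Pi>\<^sub>M i\<in>I. lborel))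
    \<le> (\<integral>\<^sup>+x. h x \<partial>(\<Pi>\<^sub>M i\<in>I. lborel))\<^sup>2"
  using assms
proof (induction I arbitrary: f g h rule: finite_induct)
  case empty
  show ?case using empty(4)[of "\<lambda>_. undefined" "\<lambda>_. undefined"]
    by (simp add: PiM_empty nn_integral_count_space_finite restrict_def)
next
  case (insert i I)
  interpret product_sigma_finite "\<lambda>_::'i. lborel :: real measure" ..
  note insert.prems(1-3)[measurable]
  define marginal where "marginal u x = (\<integral>\<^sup>+t. u (x(i := t)) \<partial>lborel)" for u :: "('i \<Rightarrow> real) \<Rightarrow> ennreal" and x
  have m[measurable]: "marginal u \<in> borel_measurable (\<Pi>\<^sub>M i\<in>I. lborel)"
    if [measurable]: "u \<in> borel_measurable (\<Pi>\<^sub>M i\<in>insert i I. lborel)" for u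
    unfolding marginal_def by measurable
  have sec: "(\<lambda>t. u (x(i := t))) \<in> borel_measurable borel"
    if [measurable]: "u \<in> borel_measurable (\<Pi>\<^sub>M i\<in>insert i I. lborel)" and x: "x \<in> extensional I" for u x
  proof -
    have "x \<in> space (\<Pi>\<^sub>M i\<in>I. lborel)" using x by (auto simp: space_PiM PiE_def)
    from measurable_comp[OF measurable_component_update[OF this \<open>i \<notin> I\<close>] that(1)]
    show ?thesis by (simp add: comp_def)
  qed
  have "(\<integral>\<^sup>+x. marginal f x \<partial>(\<Pi>\<^sub>M i\<in>I. lborel)) * (\<integral>\<^sup>+x. marginal g x \<partial>(\<Pi>\<^sub>M i\<in>I. lborel))
    \<le> (\<integral>\<^sup>+x. marginal h x \<partial>(\<Pi>\<^sub>M i\<in>I. lborel))\<^sup>2"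
  proof (rule insert.IH)
    fix x y :: "'i \<Rightarrow> real" assume xy: "x \<in> extensional I" "y \<in> extensional I"
    show "marginal f x * marginal g y \<le> (marginal h (\<lambda>i\<in>I. (x i + y i) / 2))\<^sup>2"
      unfolding marginal_def
    proof (intro prekopa_leindler_real sec insert.prems xy restrict_extensional)
      fix s t
      have "(\<lambda>j\<in>insert i I. ((x(i := s)) j + (y(i := t)) j) / 2) = (\<lambda>i\<in>I. (x i + y i) / 2)(i := (s + t) / 2)"
        using insert.hyps by (auto simp: restrict_def)
      moreover have "x(i := s) \<in> extensional (insert i I)" "y(i := t) \<in> extensional (insert i I)"
        using xy by (auto simp: extensional_def)
      ultimately show "f (x(i := s)) * g (y(i := t)) \<le> (h ((\<lambda>i\<in>I. (x i + y i) / 2)(i := (s + t) / 2)))\<^sup>2"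
        using insert.prems(4) by metis
    qed
  qed (use insert.prems in measurable)
  then show ?case
    using insert.hyps insert.prems by (simp add: product_nn_integral_insert marginal_def)
qed

theorem prekopa_leindler:
  fixes f g h :: "'a::euclidean_space \<Rightarrow> ennreal"
  assumes [measurable]: "f \<in> borel_measurable borel" "g \<in> borel_measurable borel" "h \<in> borel_measurable borel"
    and le: "\<And>x y. f x * g y \<le> (h ((1/2) *\<^sub>R (x + y)))\<^sup>2"
  shows "(\<integral>\<^sup>+x. f x \<partial>lborel) * (\<integral>\<^sup>+x. g x \<partial>lborel) \<le> (\<integral>\<^sup>+x. h x \<partial>lborel)\<^sup>2"
proof -
  let ?P = "\<Pi>\<^sub>M b\<in>(Basis::'a set). lborel :: real measure"
  let ?e = "\<lambda>v. \<Sum>b\<in>(Basis::'a set). v b *\<^sub>R b"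
  have eq: "(\<integral>\<^sup>+x. u x \<partial>lborel) = (\<integral>\<^sup>+v. u (?e v) \<partial>?P)"
    if [measurable]: "u \<in> borel_measurable borel" for u :: "'a \<Rightarrow> ennreal"
    by (subst lborel_eq) (simp add: nn_integral_distr)
  have "?e (\<lambda>b\<in>Basis. (x b + y b) / 2) = (1/2) *\<^sub>R (?e x + ?e y)" for x y
    by (simp add: scaleR_sum_right sum.distrib[symmetric] scaleR_add_right add_divide_distrib scaleR_add_left)
  then show ?thesis
    unfolding eq[OF assms(1)] eq[OF assms(2)] eq[OF assms(3)]
    using le by (intro prekopa_leindler_PiM) auto
qed

lemma nn_integral_lborel_scaleR:
  fixes f :: "'a::euclidean_space \<Rightarrow> ennreal"
  assumes [measurable]: "f \<in> borel_measurable borel" and c: "c > 0"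
  shows "(\<integral>\<^sup>+x. f x \<partial>lborel) = ennreal (c ^ DIM('a)) * (\<integral>\<^sup>+x. f (c *\<^sub>R x) \<partial>lborel)"
  using c by (subst lborel_affine[of c 0])
    (simp_all add: nn_integral_density nn_integral_distr nn_integral_cmult)

section \<open>Integrals of powers of a log-concave function\<close>
lemma log_concave_nonneg: "log_concave f \<Longrightarrow> 0 \<le> f x"
  by (auto simp: log_concave_def exp_minus_def)

lemma log_concave_weighted_geometric_mean:
  assumes "log_concave f" and t: "0 < t" "t < 1"
  shows "f x powr t * f y powr (1 - t) \<le> f (t *\<^sub>R x + (1 - t) *\<^sub>R y)"
proof -
  obtain U where U: "\<And>x. U x \<noteq> -\<infinity>" "ereal_convex U" "\<And>x. f x = exp_minus (U x)"
    using assms(1) by (auto simp: log_concave_def)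
  show ?thesis
  proof (cases "U x = \<infinity> \<or> U y = \<infinity>")
    case True
    then have "f x powr t * f y powr (1 - t) = 0" using t by (auto simp: U(3) exp_minus_def)
    then show ?thesis by (simp only: log_concave_nonneg[OF assms(1)])
  next
    case False
    then obtain u v where uv: "U x = ereal u" "U y = ereal v"
      using U(1)[of x] U(1)[of y] by (cases "U x"; cases "U y") auto
    have "U (t *\<^sub>R x + (1 - t) *\<^sub>R y) \<le> ereal t * U x + ereal (1 - t) * U y"
      using U(2) t unfolding ereal_convex_def by blast
    then have le: "U (t *\<^sub>R x + (1 - t) *\<^sub>R y) \<le> ereal (t * u + (1 - t) * v)"
      by (simp add: uv)
    then obtain w where w: "U (t *\<^sub>R x + (1 - t) *\<^sub>R y) = ereal w"
      using U(1)[of "t *\<^sub>R x + (1 - t) *\<^sub>R y"] by (cases "U (t *\<^sub>R x + (1 - t) *\<^sub>R y)") auto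
    have "f x powr t * f y powr (1 - t) = exp (- (t * u + (1 - t) * v))"
      by (simp add: U(3) uv exp_minus_def powr_def exp_add[symmetric] algebra_simps)
    also have "\<dots> \<le> exp (- w)" using le w by simp
    finally show ?thesis by (simp add: U(3) w exp_minus_def)
  qed
qed

text \<open>This is log-concavity of \<open>r \<mapsto> r\<^sup>n * \<integral> f\<^sup>r\<close>, with \<open>n\<close> the dimension, tested on the points
  \<open>1 + e\<close> and \<open>1 - e\<close> and their midpoint. The factor \<open>r\<^sup>n\<close> comes from the change of variables
  that turns \<open>f\<^sup>r\<close> into \<open>F r x = f (x / r)\<^sup>r\<close>, and \<open>F (1 + e)\<close>, \<open>F (1 - e)\<close> and \<open>f\<close>
  satisfy the hypothesis of Prekopa-Leindler: the midpoint of \<open>x\<close> and \<open>y\<close> is the convex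
  combination of \<open>x / (1 + e)\<close> and \<open>y / (1 - e)\<close> with weights \<open>(1 + e) / 2\<close> and
  \<open>(1 - e) / 2\<close>.\<close>
theorem log_concave_nn_integral_powr:
  fixes f :: "'a::euclidean_space \<Rightarrow> real"
  assumes lc: "log_concave f" and [measurable]: "f \<in> borel_measurable borel" and e: "0 < e" "e < 1"
  shows "ennreal ((1 - e\<^sup>2) ^ DIM('a))
      * (\<integral>\<^sup>+x. ennreal (f x powr (1 + e)) \<partial>lborel) * (\<integral>\<^sup>+x. ennreal (f x powr (1 - e)) \<partial>lborel)
    \<le> (\<integral>\<^sup>+x. ennreal (f x) \<partial>lborel)\<^sup>2"
proof -
  define F where "F r x = ennreal (f ((1 / r) *\<^sub>R x) powr r)" for r x
  have [measurable]: "F r \<in> borel_measurable borel" for r unfolding F_def by measurable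
  have scale: "(\<integral>\<^sup>+x. F r x \<partial>lborel) = ennreal (r ^ DIM('a)) * (\<integral>\<^sup>+x. ennreal (f x powr r) \<partial>lborel)"
    if "r > 0" for r
    using that by (subst nn_integral_lborel_scaleR[of "F r" r]) (simp_all add: F_def)
  have "(\<integral>\<^sup>+x. F (1 + e) x \<partial>lborel) * (\<integral>\<^sup>+x. F (1 - e) x \<partial>lborel) \<le> (\<integral>\<^sup>+x. ennreal (f x) \<partial>lborel)\<^sup>2"
  proof (rule prekopa_leindler)
    fix x y :: 'a
    let ?t = "(1 + e) / 2" and ?x = "(1 / (1 + e)) *\<^sub>R x" and ?y = "(1 / (1 - e)) *\<^sub>R y"
    have t: "1 - ?t = (1 - e) / 2" by (simp add: field_simps)
    have sq: "a powr r = (a powr (r / 2))\<^sup>2" for a r :: real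
      by (simp add: power2_eq_square flip: powr_add)
    have "f ?x powr (1 + e) * f ?y powr (1 - e) = (f ?x powr ?t * f ?y powr (1 - ?t))\<^sup>2"
      unfolding t sq[of _ "1 + e"] sq[of _ "1 - e"] by (simp add: power_mult_distrib)
    also have "\<dots> \<le> (f (?t *\<^sub>R ?x + (1 - ?t) *\<^sub>R ?y))\<^sup>2"
      using e by (intro power_mono log_concave_weighted_geometric_mean lc) auto
    also have "?t *\<^sub>R ?x + (1 - ?t) *\<^sub>R ?y = (1/2) *\<^sub>R (x + y)"
    proof -
      have "(1 + e) / 2 * (1 / (1 + e)) = 1/2" "(1 - e) / 2 * (1 / (1 - e)) = 1/2"
        using e by simp_all
      then show ?thesis by (simp only: t scaleR_scaleR scaleR_add_right)
    qed
    finally show "F (1 + e) x * F (1 - e) y \<le> (ennreal (f ((1/2) *\<^sub>R (x + y))))\<^sup>2"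
      using log_concave_nonneg[OF lc] by (simp add: F_def ennreal_mult[symmetric] ennreal_power)
  qed measurable
  moreover have "ennreal ((1 - e\<^sup>2) ^ DIM('a)) = ennreal ((1 + e) ^ DIM('a)) * ennreal ((1 - e) ^ DIM('a))"
    using e by (simp add: ennreal_mult[symmetric] power_mult_distrib[symmetric] power2_eq_square algebra_simps)
  ultimately show ?thesis
    using e by (simp add: scale ac_simps)
qed

section \<open>From exponential moments to the variance\<close>
lemma exp_add_exp_minus_ge:
  fixes x :: real
  shows "2 + x\<^sup>2 \<le> exp x + exp (- x)"
proof -
  have "\<bar>x / 2\<bar> \<le> \<bar>(exp (x / 2) - inverse (exp (x / 2))) / 2\<bar>" by (rule real_le_abs_sinh)
  then have "\<bar>x\<bar> \<le> \<bar>exp (x / 2) - exp (- (x / 2))\<bar>" by (simp add: exp_minus)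
  then have "x\<^sup>2 \<le> (exp (x / 2) - exp (- (x / 2)))\<^sup>2" by (rule abs_le_square_iff[THEN iffD1])
  also have "\<dots> = exp x + exp (- x) - 2"
    by (simp add: power2_eq_square algebra_simps flip: exp_add)
  finally show ?thesis by simp
qed

text \<open>If \<open>Y'\<close> is an independent copy of \<open>Y\<close>, then twice the product of the two exponential moments
  is the mean of \<open>exp (e * (Y - Y')) + exp (- e * (Y - Y'))\<close>, which is at least
  \<open>2 + e\<^sup>2 * E (Y - Y')\<^sup>2 = 2 + 2 * e\<^sup>2 * Var Y\<close>. So the bound forces
  \<open>(1 - e\<^sup>2)\<^sup>n * (1 + e\<^sup>2 * Var Y) \<le> 1\<close>, and \<open>e \<longlonglongrightarrow> 0\<close> gives \<open>Var Y \<le> n\<close>. All moments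
  involved exist because the bound is an inequality in \<open>[0, \<infinity>]\<close> between a finite constant and a product
  of positive factors.\<close>
lemma (in prob_space) variance_le_of_exponential_moments:
  fixes Y :: "'a \<Rightarrow> real"
  assumes Y[measurable]: "Y \<in> borel_measurable M"
    and bound: "\<And>e. 0 < e \<Longrightarrow> e < 1 \<Longrightarrow>
      ennreal ((1 - e\<^sup>2) ^ n) * (\<integral>\<^sup>+\<omega>. ennreal (exp (- e * Y \<omega>)) \<partial>M) * (\<integral>\<^sup>+\<omega>. ennreal (exp (e * Y \<omega>)) \<partial>M) \<le> 1"
  shows "integrable M (\<lambda>\<omega>. (Y \<omega>)\<^sup>2)" and "variance Y \<le> real n"
proof -
  have pos: "(\<integral>\<^sup>+\<omega>. ennreal (exp (r * Y \<omega>)) \<partial>M) \<noteq> 0" for r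
  proof
    assume "(\<integral>\<^sup>+\<omega>. ennreal (exp (r * Y \<omega>)) \<partial>M) = 0"
    then have "AE \<omega> in M. False" by (subst (asm) nn_integral_0_iff_AE) (auto simp: ennreal_eq_0_iff not_le[symmetric])
    then show False by simp
  qed
  have fin: "integrable M (\<lambda>\<omega>. exp (e * Y \<omega>))" "integrable M (\<lambda>\<omega>. exp (- e * Y \<omega>))"
    if e: "0 < e" "e < 1" for e
  proof -
    have "0 < (1 - e\<^sup>2) ^ n" using e by (simp add: power_less_one_iff)
    then have ne: "ennreal ((1 - e\<^sup>2) ^ n) \<noteq> 0" by (simp add: ennreal_eq_0_iff not_le del: ennreal_power)
    have "ennreal ((1 - e\<^sup>2) ^ n) * (\<integral>\<^sup>+\<omega>. ennreal (exp (- e * Y \<omega>)) \<partial>M) * (\<integral>\<^sup>+\<omega>. ennreal (exp (e * Y \<omega>)) \<partial>M) < \<top>"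
      using bound[OF e] by (rule le_less_trans) simp
    then have "(\<integral>\<^sup>+\<omega>. ennreal (exp (- e * Y \<omega>)) \<partial>M) < \<top>" "(\<integral>\<^sup>+\<omega>. ennreal (exp (e * Y \<omega>)) \<partial>M) < \<top>"
      using ne pos[of e] pos[of "- e"] by (simp_all add: ennreal_mult_less_top)
    then show "integrable M (\<lambda>\<omega>. exp (e * Y \<omega>))" "integrable M (\<lambda>\<omega>. exp (- e * Y \<omega>))"
      by (auto intro!: integrableI_nonneg)
  qed
  have real_bound: "(1 - e\<^sup>2) ^ n * (expectation (\<lambda>\<omega>. exp (- e * Y \<omega>)) * expectation (\<lambda>\<omega>. exp (e * Y \<omega>))) \<le> 1"
    if e: "0 < e" "e < 1" for e
  proof -
    have "0 \<le> (1 - e\<^sup>2) ^ n" using e by (simp add: power_le_one_iff)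
    moreover have "ennreal ((1 - e\<^sup>2) ^ n) * ennreal (expectation (\<lambda>\<omega>. exp (- e * Y \<omega>)))
       * ennreal (expectation (\<lambda>\<omega>. exp (e * Y \<omega>))) \<le> 1"
      using bound[OF e] fin[OF e] by (simp only: nn_integral_eq_integral[OF _ AE_I2[OF exp_ge_zero]])
    ultimately show ?thesis
      by (simp add: ennreal_mult[symmetric] mult.assoc del: ennreal_power)
  qed
  show sq: "integrable M (\<lambda>\<omega>. (Y \<omega>)\<^sup>2)"
  proof (rule Bochner_Integration.integrable_bound)
    show "integrable M (\<lambda>\<omega>. 4 * (exp (1/2 * Y \<omega>) + exp (- (1/2) * Y \<omega>)))"
      using fin[of "1/2"] by (intro integrable_mult_right Bochner_Integration.integrable_add) auto
    show "AE \<omega> in M. norm ((Y \<omega>)\<^sup>2) \<le> norm (4 * (exp (1/2 * Y \<omega>) + exp (- (1/2) * Y \<omega>)))"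
    proof (rule AE_I2)
      fix \<omega>
      show "norm ((Y \<omega>)\<^sup>2) \<le> norm (4 * (exp (1/2 * Y \<omega>) + exp (- (1/2) * Y \<omega>)))"
        using exp_add_exp_minus_ge[of "Y \<omega> / 2"] by (simp add: power_divide)
    qed
  qed simp
  have int: "integrable M Y" using sq by (rule square_integrable_imp_integrable[OF Y])
  define V where "V = variance Y"
  have V: "V = expectation (\<lambda>\<omega>. (Y \<omega>)\<^sup>2) - (expectation Y)\<^sup>2" "V \<ge> 0"
    using int sq variance_positive[of Y] by (simp_all add: V_def variance_eq)
  have prod: "1 + e\<^sup>2 * V \<le> expectation (\<lambda>\<omega>. exp (- e * Y \<omega>)) * expectation (\<lambda>\<omega>. exp (e * Y \<omega>))"
    (is "_ \<le> ?b * ?a") if e: "0 < e" "e < 1" for e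
  proof -
    note [simp] = fin[OF e] fin[OF e, simplified] int sq
    let ?m = "expectation Y" and ?s = "expectation (\<lambda>\<omega>. (Y \<omega>)\<^sup>2)"
    \<comment> \<open>Two successive expectations of the pointwise inequality replace the independent copy: first
      over \<open>Y\<close> with the other variable fixed to \<open>u\<close>, then with \<open>Y\<close> put for \<open>u\<close>.\<close>
    have "2 + e\<^sup>2 * (u\<^sup>2 - 2 * u * ?m + ?s) \<le> exp (e * u) * ?b + exp (- e * u) * ?a" for u
    proof -
      have "expectation (\<lambda>\<omega>. 2 + e\<^sup>2 * (u\<^sup>2 - 2 * u * Y \<omega> + (Y \<omega>)\<^sup>2))
         \<le> expectation (\<lambda>\<omega>. exp (e * u) * exp (- e * Y \<omega>) + exp (- e * u) * exp (e * Y \<omega>))"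
      proof (rule integral_mono)
        fix \<omega>
        show "2 + e\<^sup>2 * (u\<^sup>2 - 2 * u * Y \<omega> + (Y \<omega>)\<^sup>2) \<le> exp (e * u) * exp (- e * Y \<omega>) + exp (- e * u) * exp (e * Y \<omega>)"
          using exp_add_exp_minus_ge[of "e * (u - Y \<omega>)"]
          by (simp add: power2_eq_square algebra_simps flip: exp_add)
      qed simp_all
      then show ?thesis by (simp add: prob_space)
    qed
    then have "expectation (\<lambda>\<omega>. 2 + e\<^sup>2 * ((Y \<omega>)\<^sup>2 - 2 * Y \<omega> * ?m + ?s))
       \<le> expectation (\<lambda>\<omega>. exp (e * Y \<omega>) * ?b + exp (- e * Y \<omega>) * ?a)"
      by (intro integral_mono) simp_all
    then have "2 + e\<^sup>2 * (?s - 2 * ?m * ?m + ?s) \<le> ?a * ?b + ?b * ?a"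
      by (simp add: prob_space mult.assoc)
    then show ?thesis by (simp add: V power2_eq_square algebra_simps)
  qed
  have ineq: "V \<le> n + n * V * e\<^sup>2" if e: "0 < e" "e < 1" for e
  proof -
    have "(1 + real n * (- e\<^sup>2)) * (1 + e\<^sup>2 * V) \<le> (1 + (- e\<^sup>2)) ^ n * (1 + e\<^sup>2 * V)"
      using V e by (intro mult_right_mono Bernoulli_inequality) (auto simp: power_le_one_iff)
    also have "\<dots> \<le> (1 - e\<^sup>2) ^ n * (expectation (\<lambda>\<omega>. exp (- e * Y \<omega>)) * expectation (\<lambda>\<omega>. exp (e * Y \<omega>)))"
      using prod[OF e] e by (simp add: mult_left_mono power_le_one_iff)
    also have "\<dots> \<le> 1" by (rule real_bound[OF e])
    finally have "e\<^sup>2 * V \<le> e\<^sup>2 * (n + n * V * e\<^sup>2)"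
      by (simp add: algebra_simps)
    then show ?thesis using e by simp
  qed
  have "((\<lambda>e::real. n + n * V * e\<^sup>2) \<longlongrightarrow> n + n * V * 0\<^sup>2) (at_right 0)"
    by (intro tendsto_intros)
  moreover have "eventually (\<lambda>e. V \<le> n + n * V * e\<^sup>2) (at_right 0)"
    using eventually_at_right_less eventually_at_rightI[of 0 "1::real"] ineq
    by (intro eventually_at_rightI[of 0 1]) auto
  ultimately have "V \<le> n + n * V * 0\<^sup>2" by (rule tendsto_lowerbound) simp
  then show "variance Y \<le> real n" by (simp add: V_def)
qed

section \<open>The varentropy bound\<close>
theorem theorem2p3:
  fixes M :: "'b measure"
    and X :: "'b \<Rightarrow> real ^ 'n"
    and f :: "real ^ 'n \<Rightarrow> real"
  assumes "prob_space M"
    and "distributed M lborel X (\<lambda>x. ennreal (f x))"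
    and "log_concave f"
  shows "integrable M (\<lambda>\<omega>. (information_content f (X \<omega>))\<^sup>2)
       \<and> varentropy M X f \<le> real CARD('n)"
proof -
  interpret prob_space M by fact
  note D = assms(2) and nonneg = log_concave_nonneg[OF assms(3)]
  have [measurable]: "f \<in> borel_measurable borel"
    using distributed_real_measurable[OF _ D] nonneg by simp
  have [measurable]: "X \<in> measurable M borel" using distributed_measurable[OF D] by simp
  \<comment> \<open>Where \<open>f\<close> vanishes, \<open>ln 0 = 0\<close> makes the exponential equal to 1, but the density factor
    \<open>f x = 0\<close> agrees with \<open>0 powr (1 - r) = 0\<close>.\<close>
  have moment: "(\<integral>\<^sup>+\<omega>. ennreal (exp (r * information_content f (X \<omega>))) \<partial>M)
      = (\<integral>\<^sup>+x. ennreal (f x powr (1 - r)) \<partial>lborel)" for r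
  proof -
    have "(\<integral>\<^sup>+\<omega>. ennreal (exp (r * information_content f (X \<omega>))) \<partial>M)
       = (\<integral>\<^sup>+x. ennreal (f x) * ennreal (exp (r * information_content f x)) \<partial>lborel)"
      unfolding information_content_def
      by (rule distributed_nn_integral[OF D, symmetric]) measurable
    also have "\<dots> = (\<integral>\<^sup>+x. ennreal (f x powr (1 - r)) \<partial>lborel)"
    proof (rule nn_integral_cong)
      fix x
      have "f x * exp (r * information_content f x) = f x powr (1 - r)"
      proof (cases "f x = 0")
        case False
        then have "f x * exp (r * information_content f x) = exp (ln (f x)) * exp (r * information_content f x)"
          using nonneg[of x] by simp
        then show ?thesis
          using False by (simp add: powr_def information_content_def algebra_simps flip: exp_add)
      qed simp
      then show "ennreal (f x) * ennreal (exp (r * information_content f x)) = ennreal (f x powr (1 - r))"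
        using nonneg[of x] by (simp add: ennreal_mult[symmetric])
    qed
    finally show ?thesis .
  qed
  have one: "(\<integral>\<^sup>+x. ennreal (f x) \<partial>lborel) = 1"
    using distributed_nn_integral[OF D, of "\<lambda>_. 1"] by (simp add: emeasure_space_1)
  have bound: "ennreal ((1 - e\<^sup>2) ^ CARD('n))
      * (\<integral>\<^sup>+\<omega>. ennreal (exp (- e * information_content f (X \<omega>))) \<partial>M)
      * (\<integral>\<^sup>+\<omega>. ennreal (exp (e * information_content f (X \<omega>))) \<partial>M) \<le> 1" if "0 < e" "e < 1" for e
    unfolding moment using log_concave_nn_integral_powr[OF assms(3) _ that] by (simp add: one)
  have "(\<lambda>\<omega>. information_content f (X \<omega>)) \<in> borel_measurable M"
    unfolding information_content_def by measurable
  from variance_le_of_exponential_moments[OF this bound] show ?thesis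
    by (simp add: varentropy_def)
qed

end
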